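(* Consider an instance of the Capacitated Delivery Problem with Parking (CDPP) with loading times $f_j=f\cdot|\sigma_j|$ for some constant $f\ge0$. For $i\in\Pi\cap C$, let $\sigma_{j_i}=\{i\}$. There exists an optimal solution of the CDPP satisfying $$\sum_{i\in\Pi\cap C}\ \sum_{k\in\Pi\setminus\{i\}}x_{ki}=\sum_{i\in\Pi\cap C}y_{ij_i}.$$
   Context: CDPP data. $C$ is a finite set of $n\ge1$ customers, each requiring one package. $\Pi$ is a finite set consisting of the depot $0$ (with $0\notin C$) and the parking locations $\Pi\setminus\{0\}\neq\emptyset$; parking locations may or may not be customers. $p_i\ge0$ is the search time for parking at $i\in\Pi\setminus\{0\}$. $S$ is the set of customer service sets $\sigma_j$: the nonempty subsets of $C$ satisfying the delivery person's capacity restrictions (an upper bound on the number of packages $|\sigma_j|\le q$, and/or on total weight $\sum_{i\in\sigma_j}\psi_i\le\Psi$, and/or on total volume $\sum_{i\in\sigma_j}v_i\le V$, with nonnegative weights and volumes); every singleton $\{i\}$, $i\in C$, satisfies the capacity restrictions. For $i\in C$, $J_i=\{\sigma_j\in S: i\in\sigma_j\}$. Times. $D(i,k)\ge0$ is the driving time from $i$ to $k$ ($i,k\in\Pi$) and $W(i,k)\ge0$ is the walking time from $i$ to $k$ ($i,k\in C\cup\Pi\setminus\{0\}$), with $D(i,i)=W(i,i)=0$; both satisfy the triangle inequality. Set $d_{ik}=D(i,k)+p_k$ for $k\neq0$, $i\ne k$, and $d_{i0}=D(i,0)$. For $i\in\Pi\setminus\{0\}$ and $\sigma_j\in S$, $w_{ij}$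 is the minimum over orderings $(c_1,\dots,c_m)$ of $\sigma_j$ of $W(i,c_1)+W(c_1,c_2)+\cdots+W(c_{m-1},c_m)+W(c_m,i)$. $f_j$ is the time to load the packages of $\sigma_j$. CDPP. Minimize $$\sum_{i\in\Pi}\sum_{k\in\Pi\setminus\{i\}}x_{ik}d_{ik}+\sum_{i\in\Pi\setminus\{0\}}\sum_{\sigma_j\in S}y_{ij}(w_{ij}+f_j)$$ subject to (1) $\sum_{i\in\Pi\setminus\{0\}}x_{0i}=1$ and $\sum_{i\in\Pi\setminus\{0\}}x_{i0}=1$; (2) $\sum_{k\in\Pi\setminus\{0\}}\sum_{\sigma_j\in J_i}y_{kj}=1$ for all $i\in C$; (3) $\sum_{k\in\Pi\setminus\{i\}}x_{ki}=\sum_{k\in\Pi\setminus\{i\}}x_{ik}$ for all $i\in\Pi\setminus\{0\}$; (4) $y_{ij}\le\sum_{k\in\Pi\setminus\{i\}}x_{ki}$ for all $i\in\Pi\setminus\{0\}$, $\sigma_j\in S$; (5) $\sum_{i\in\Pi\setminus\{0\}}v_{0i}=n$; (6) $v_{ik}\le n\,x_{ik}$ for all $i\in\Pi$, $k\in\Pi\setminus\{0\}$, $i\ne k$; (7) $\sum_{k\in\Pi\setminus\{i\}}v_{ki}-\sum_{k\in\Pi\setminus\{0,i\}}v_{ik}=\sum_{\sigma_j\in S}|\sigma_j|y_{ij}$ for all $i\in\Pi\setminus\{0\}$; (8) $x_{ik}\in\{0,1\}$ ($i,k\in\Pi$, $i\neq k$), $y_{ij}\in\{0,1\}$ ($i\in\Pi\setminus\{0\}$,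 $\sigma_j\in S$), $v_{ik}\in\mathbb Z_{\ge0}$ ($i\in\Pi$, $k\in\Pi\setminus\{0\}$, $i\ne k$). Here $x_{ik}=1$ means the vehicle drives from $i$ to $k$ (and parks at $k$ if $k\ne0$), $y_{ij}=1$ means $\sigma_j$ is served on foot from the vehicle parked at $i$, and $v_{ik}$ is the flow of packages from $i$ to $k$. An optimal solution is an optimal solution of this program. *)

theory Defs
  imports Complex_Main "HOL-Combinatorics.Multiset_Permutations"
begin

text \<open>
  Data of the Capacitated Delivery Problem with Parking. Customers and locations live in one type,
  because a parking location may itself be a customer. A capacity bound \<open>None\<close> means that
  the corresponding restriction is not imposed.
\<close>

record 'a cdpp =
  customers :: "'a set"
  locs :: "'a set"  \<comment> \<open>depot and parking locations\<close>
  depot :: 'a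
  search_time :: "'a \<Rightarrow> real"
  drive :: "'a \<Rightarrow> 'a \<Rightarrow> real"
  walk :: "'a \<Rightarrow> 'a \<Rightarrow> real"
  max_packages :: "nat option"
  weight :: "'a \<Rightarrow> real"
  max_weight :: "real option"
  volume :: "'a \<Rightarrow> real"
  max_volume :: "real option"
  load_time :: "'a set \<Rightarrow> real"

definition parking :: "'a cdpp \<Rightarrow> 'a set" where
  "parking I = locs I - {depot I}"

definition within_capacity :: "'a cdpp \<Rightarrow> 'a set \<Rightarrow> bool" where
  "within_capacity I \<sigma> \<longleftrightarrow>
     (\<forall>q. max_packages I = Some q \<longrightarrow> card \<sigma> \<le> q) \<and>
     (\<forall>b. max_weight I = Some b \<longrightarrow> (\<Sum>i\<in>\<sigma>. weight I i) \<le> b) \<and>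
     (\<forall>b. max_volume I = Some b \<longrightarrow> (\<Sum>i\<in>\<sigma>. volume I i) \<le> b)"

definition service_sets :: "'a cdpp \<Rightarrow> 'a set set" where
  "service_sets I = {\<sigma>. \<sigma> \<noteq> {} \<and> \<sigma> \<subseteq> customers I \<and> within_capacity I \<sigma>}"

definition service_sets_of :: "'a cdpp \<Rightarrow> 'a \<Rightarrow> 'a set set" where
  "service_sets_of I i = {\<sigma> \<in> service_sets I. i \<in> \<sigma>}"

definition travel_time_on :: "'a set \<Rightarrow> ('a \<Rightarrow> 'a \<Rightarrow> real) \<Rightarrow> bool" where
  "travel_time_on A T \<longleftrightarrow>
     (\<forall>i\<in>A. \<forall>k\<in>A. T i k \<ge> 0) \<and>
     (\<forall>i\<in>A. T i i = 0) \<and>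
     (\<forall>i\<in>A. \<forall>j\<in>A. \<forall>k\<in>A. T i k \<le> T i j + T j k)"

definition cdpp_instance :: "'a cdpp \<Rightarrow> bool" where
  "cdpp_instance I \<longleftrightarrow>
     finite (customers I) \<and> customers I \<noteq> {} \<and>
     finite (locs I) \<and> depot I \<in> locs I \<and> depot I \<notin> customers I \<and> parking I \<noteq> {} \<and>
     (\<forall>i\<in>parking I. search_time I i \<ge> 0) \<and>
     travel_time_on (locs I) (drive I) \<and>
     travel_time_on (customers I \<union> parking I) (walk I) \<and>
     (max_packages I \<noteq> None \<or> max_weight I \<noteq> None \<or> max_volume I \<noteq> None) \<and>
     (\<forall>i\<in>customers I. weight I i \<ge> 0 \<and> volume I i \<ge> 0) \<and>
     (\<forall>i\<in>customers I. within_capacity I {i})"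

definition drive_cost :: "'a cdpp \<Rightarrow> 'a \<Rightarrow> 'a \<Rightarrow> real" where
  "drive_cost I i k = (if k = depot I then drive I i k else drive I i k + search_time I k)"

text \<open>Length of the closed walk from \<open>i\<close> through the customers \<open>cs\<close>, in order, back to \<open>i\<close>.\<close>

definition tour_time :: "'a cdpp \<Rightarrow> 'a \<Rightarrow> 'a list \<Rightarrow> real" where
  "tour_time I i cs = (\<Sum>(a, b)\<leftarrow>zip (i # cs) (cs @ [i]). walk I a b)"

definition walk_cost :: "'a cdpp \<Rightarrow> 'a \<Rightarrow> 'a set \<Rightarrow> real" where
  "walk_cost I i \<sigma> = Min (tour_time I i ` permutations_of_set \<sigma>)"

text \<open>
  The variables \<open>x\<close>, \<open>y\<close>, \<open>v\<close> of the integer program are real-valued functions; integrality is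
  part of feasibility. Only their values on the index sets of the program matter.
\<close>

definition cdpp_cost ::
  "'a cdpp \<Rightarrow> ('a \<Rightarrow> 'a \<Rightarrow> real) \<Rightarrow> ('a \<Rightarrow> 'a set \<Rightarrow> real) \<Rightarrow> real" where
  "cdpp_cost I x y =
     (\<Sum>i\<in>locs I. \<Sum>k\<in>locs I - {i}. x i k * drive_cost I i k) +
     (\<Sum>i\<in>parking I. \<Sum>\<sigma>\<in>service_sets I. y i \<sigma> * (walk_cost I i \<sigma> + load_time I \<sigma>))"

definition cdpp_feasible ::
  "'a cdpp \<Rightarrow> ('a \<Rightarrow> 'a \<Rightarrow> real) \<Rightarrow> ('a \<Rightarrow> 'a set \<Rightarrow> real) \<Rightarrow> ('a \<Rightarrow> 'a \<Rightarrow> real) \<Rightarrow> bool" where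
  "cdpp_feasible I x y v \<longleftrightarrow>
     (\<Sum>i\<in>parking I. x (depot I) i) = 1 \<and> (\<Sum>i\<in>parking I. x i (depot I)) = 1 \<and>
     (\<forall>i\<in>customers I. (\<Sum>k\<in>parking I. \<Sum>\<sigma>\<in>service_sets_of I i. y k \<sigma>) = 1) \<and>
     (\<forall>i\<in>parking I. (\<Sum>k\<in>locs I - {i}. x k i) = (\<Sum>k\<in>locs I - {i}. x i k)) \<and>
     (\<forall>i\<in>parking I. \<forall>\<sigma>\<in>service_sets I. y i \<sigma> \<le> (\<Sum>k\<in>locs I - {i}. x k i)) \<and>
     (\<Sum>i\<in>parking I. v (depot I) i) = real (card (customers I)) \<and>
     (\<forall>i\<in>locs I. \<forall>k\<in>parking I. i \<noteq> k \<longrightarrow> v i k \<le> real (card (customers I)) * x i k) \<and>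
     (\<forall>i\<in>parking I.
        (\<Sum>k\<in>locs I - {i}. v k i) - (\<Sum>k\<in>locs I - {depot I, i}. v i k) =
        (\<Sum>\<sigma>\<in>service_sets I. real (card \<sigma>) * y i \<sigma>)) \<and>
     (\<forall>i\<in>locs I. \<forall>k\<in>locs I. i \<noteq> k \<longrightarrow> x i k \<in> {0, 1}) \<and>
     (\<forall>i\<in>parking I. \<forall>\<sigma>\<in>service_sets I. y i \<sigma> \<in> {0, 1}) \<and>
     (\<forall>i\<in>locs I. \<forall>k\<in>parking I. i \<noteq> k \<longrightarrow> v i k \<in> \<nat>)"

definition cdpp_optimal ::
  "'a cdpp \<Rightarrow> ('a \<Rightarrow> 'a \<Rightarrow> real) \<Rightarrow> ('a \<Rightarrow> 'a set \<Rightarrow> real) \<Rightarrow> ('a \<Rightarrow> 'a \<Rightarrow> real) \<Rightarrow> bool" where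
  "cdpp_optimal I x y v \<longleftrightarrow>
     cdpp_feasible I x y v \<and>
     (\<forall>x' y' v'. cdpp_feasible I x' y' v' \<longrightarrow> cdpp_cost I x y \<le> cdpp_cost I x' y')"

end

theory Submission
  imports Defs "HOL-Library.Sublist" "Graph_Theory.Euler"
begin

text \<open>
  Parking at a customer \<open>i\<close>, one may as well serve \<open>i\<close> from there: the walk to \<open>i\<close> takes no time,
  taking \<open>i\<close> out of the service set that used to contain it does not lengthen that walk, by the
  triangle inequality, and the total loading time \<open>f\<close> times the number of customers is the same for
  every assignment (\<open>serve_in_place_walk_le\<close>, \<open>service_cost_split\<close>). After this change every
  visited parking customer \<open>i\<close> has \<open>y i {i} = 1\<close>, and an unvisited one has \<open>y i {i} = 0\<close>.
  The claimed identity then says that the number of arrivals at \<open>i\<close> is \<open>1\<close> or \<open>0\<close> accordingly.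

  Two obstacles lie in the route. A feasible route may visit a parking location several times, and it
  may contain closed tours disconnected from the depot, where no package can arrive, so that moving
  demand there would make the flow constraints infeasible. Both are removed without extra cost: the
  flow equations show that all demand lies in the component of the depot
  (\<open>no_demand_outside_depot_component\<close>); this component is balanced, so it has a closed Euler trail,
  whose length is at most the driving cost; and by the triangle inequality the trail can be shortened
  to a simple tour through the same locations (\<open>shortcut_tour\<close>).

  Conversely, a simple tour and any assignment that uses only its stops form a feasible solution
  (\<open>tour_feasible\<close>). Starting from an optimal solution, which exists because only finitely many costs
  occur, the simple tour with the changed assignment is feasible and no more expensive, hence
  optimal, and it visits each of its stops exactly once.
\<close>

section \<open>Shortcutting closed routes\<close>

text \<open>
  Both the walk of the delivery person and the drive of the vehicle are closed routes; their times
  are instances of this sum, so that one shortcut lemma serves both.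
\<close>

fun route_length :: "('a \<Rightarrow> 'a \<Rightarrow> real) \<Rightarrow> 'a list \<Rightarrow> real" where
  "route_length T (a # b # xs) = T a b + route_length T (b # xs)"
| "route_length T _ = 0"

lemma sum_list_zip_eq_route_length:
  "(\<Sum>(a, b)\<leftarrow>zip (u # cs) (cs @ [w]). T a b) = route_length T (u # cs @ [w])"
  by (induction cs arbitrary: u) auto

lemma route_length_eq_sum_nth:
  "route_length T xs = (\<Sum>r<length xs - 1. T (xs ! r) (xs ! Suc r))"
  by (induction T xs rule: route_length.induct) (simp_all add: sum.lessThan_Suc_shift del: sum.lessThan_Suc)

text \<open>
  Leaving out a point of a route replaces the two steps through it by one step, which the triangle
  inequality shows to be no longer. The induction peels off the first intermediate point, so the
  start point has to vary.
\<close>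

lemma route_length_subseq_le:
  assumes "subseq ys xs"
    and tri: "\<And>a b c. a \<in> A \<Longrightarrow> b \<in> A \<Longrightarrow> c \<in> A \<Longrightarrow> T a c \<le> T a b + T b c"
    and "u \<in> A" "w \<in> A" "set xs \<subseteq> A"
  shows "route_length T (u # ys @ [w]) \<le> route_length T (u # xs @ [w])"
  using assms(1,3,5)
proof (induction arbitrary: u rule: list_emb.induct)
  case (list_emb_Nil xs)
  then show ?case
  proof (induction xs arbitrary: u)
    case (Cons x xs)
    have "T u w \<le> T u x + T x w" using Cons.prems assms(4) by (intro tri) auto
    then show ?case using Cons.IH[of x] Cons.prems by simp
  qed simp
next
  case (list_emb_Cons ys xs x)
  have sub: "set ys \<subseteq> set xs" using list_emb_Cons.hyps by (auto dest: list_emb_set)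
  have "route_length T (u # ys @ [w]) \<le> T u x + route_length T (x # ys @ [w])"
  proof (cases ys)
    case Nil
    then show ?thesis using tri[of u x w] list_emb_Cons.prems assms(4) by simp
  next
    case (Cons z zs)
    then have "z \<in> A" using sub list_emb_Cons.prems by auto
    then show ?thesis using tri[of u x z] list_emb_Cons.prems Cons by simp
  qed
  also have "\<dots> \<le> T u x + route_length T (x # xs @ [w])"
    using list_emb_Cons.IH[of x] list_emb_Cons.prems by simp
  finally show ?case by simp
next
  case (list_emb_Cons2 x y xs ys)
  then show ?case by auto
qed

lemma subseq_remdups: "subseq (remdups xs) xs"
  by (induction xs) auto

section \<open>Walking\<close>

lemma tour_time_eq_route_length: "tour_time I i cs = route_length (walk I) (i # cs @ [i])"
  by (simp only: tour_time_def sum_list_zip_eq_route_length)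

text \<open>
  An optimal tour through \<open>\<tau>\<close>, restricted to the customers of \<open>\<sigma>\<close>, is a tour through \<open>\<sigma>\<close> obtained
  by shortcuts.
\<close>

lemma walk_cost_mono:
  assumes tri: "travel_time_on A (walk I)" and "i \<in> A" "\<tau> \<subseteq> A" "finite \<tau>" "\<sigma> \<subseteq> \<tau>"
  shows "walk_cost I i \<sigma> \<le> walk_cost I i \<tau>"
proof -
  have fin: "finite \<sigma>" using assms by (auto intro: finite_subset)
  have "walk_cost I i \<tau> \<in> tour_time I i ` permutations_of_set \<tau>"
    unfolding walk_cost_def using assms by (intro Min_in) (auto simp: permutations_of_set_empty_iff)
  then obtain cs where cs: "cs \<in> permutations_of_set \<tau>" "walk_cost I i \<tau> = tour_time I i cs" by auto
  let ?ds = "filter (\<lambda>c. c \<in> \<sigma>) cs"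
  have ds: "?ds \<in> permutations_of_set \<sigma>"
    using cs(1) assms(5) by (auto simp: permutations_of_set_def)
  have "walk_cost I i \<sigma> \<le> tour_time I i ?ds"
    unfolding walk_cost_def using fin ds by (intro Min_le) auto
  also have "\<dots> \<le> tour_time I i cs"
    unfolding tour_time_eq_route_length
    using tri assms(2,3) cs(1)
    by (intro route_length_subseq_le[where A=A]) (auto simp: travel_time_on_def permutations_of_set_def)
  finally show ?thesis using cs(2) by simp
qed

lemma walk_cost_at_customer:
  "walk I i i = 0 \<Longrightarrow> walk_cost I i {i} = 0"
  by (simp add: walk_cost_def tour_time_def)

section \<open>Closed routes through a balanced graph\<close>

lemma cas_awalk_verts:
  "pre_digraph.cas G u p w \<Longrightarrow> pre_digraph.awalk_verts G u p = u # map (head G) p"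
  by (induction p arbitrary: u) (auto simp: pre_digraph.awalk_verts.simps pre_digraph.cas.simps elim: )

lemma route_length_awalk_verts:
  "pre_digraph.cas G u p w \<Longrightarrow>
   route_length T (u # map (head G) p) = (\<Sum>e\<leftarrow>p. T (tail G e) (head G e))"
  by (induction p arbitrary: u) (auto simp: pre_digraph.cas.simps)

text \<open>
  Euler's theorem, applied to the weak component \<open>R\<close> of \<open>d\<close>: restricting to a weak component changes
  no degree, so the component stays balanced, and a closed Euler trail started at \<open>d\<close> uses each arc of
  the component once. Its length is therefore the total length of these arcs, whatever \<open>T\<close> is.
  The arc out of \<open>d\<close> excludes the empty trail, which has no return step to \<open>d\<close>.
\<close>

lemma closed_route_through_component:
  fixes E :: "('a \<times> 'a) set"
  assumes fin: "finite E"
    and bal: "\<And>u. card {k. (u, k) \<in> E} = card {k. (k, u) \<in> E}"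
    and out: "(d, e) \<in> E"
    and R: "R = (E \<union> E\<inverse>)\<^sup>* `` {d}"
  obtains ws where "set (d # ws) = R"
    and "\<And>T. route_length T (d # ws @ [d]) = (\<Sum>(a, b)\<in>E \<inter> R \<times> R. T a b)"
proof -
  define G where "G = \<lparr>verts = R, arcs = E \<inter> R \<times> R, tail = fst, head = snd\<rparr>"
  have G: "verts G = R" "arcs G = E \<inter> R \<times> R" "tail G = fst" "head G = snd"
    by (simp_all add: G_def)
  have dR: "d \<in> R" using R by auto
  (* arcs never cross the boundary of the component, so degrees inside it are the original ones *)
  have cl: "a \<in> R \<longleftrightarrow> b \<in> R" if "(a, b) \<in> E" for a b
    unfolding R using that
    by (auto intro: rtrancl_into_rtrancl)
  have "R \<subseteq> insert d (fst ` E \<union> snd ` E)"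
  proof
    fix z assume "z \<in> R"
    then have "(d, z) \<in> (E \<union> E\<inverse>)\<^sup>*" using R by auto
    then show "z \<in> insert d (fst ` E \<union> snd ` E)" by (cases rule: rtranclE) (force+)
  qed
  then have finR: "finite R" using fin by (auto intro: finite_subset)
  interpret fin_digraph G
    using fin finR by unfold_locales (auto simp: G)
  have reach: "d \<rightarrow>\<^sup>*\<^bsub>mk_symmetric G\<^esub> z" if "(d, z) \<in> (E \<union> E\<inverse>)\<^sup>*" for z
    using that
  proof (induction rule: rtrancl_induct)
    case base
    show ?case using dR by (auto simp: reachable_def G mk_symmetric_def)
  next
    case (step y z)
    have "y \<in> R" "z \<in> R" using step.hyps R by (auto intro: rtrancl_into_rtrancl)
    then have "(y, z) \<in> arcs_ends (mk_symmetric G)" "z \<in> verts (mk_symmetric G)"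
      using step.hyps(2) by (auto simp: mk_symmetric_def G arcs_ends_conv intro: bexI[of _ "(z, y)"])
    then show ?case using step.IH by (auto simp: reachable_def intro: rtrancl_on_into_rtrancl_on)
  qed
  have "connected G"
  proof (rule connectedI)
    show "verts G \<noteq> {}" using dR G by auto
    fix a b assume "a \<in> verts G" "b \<in> verts G"
    then have "d \<rightarrow>\<^sup>*\<^bsub>mk_symmetric G\<^esub> a" "d \<rightarrow>\<^sup>*\<^bsub>mk_symmetric G\<^esub> b"
      using reach R G by auto
    then show "a \<rightarrow>\<^sup>*\<^bsub>mk_symmetric G\<^esub> b"
      using symmetric_reachable[OF symmetric_mk_symmetric] rtrancl_on_trans
      unfolding reachable_def by metis
  qed
  moreover have "in_degree G u = out_degree G u" if "u \<in> verts G" for u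
  proof -
    have "in_arcs G u = (\<lambda>k. (k, u)) ` {k. (k, u) \<in> E}"
      using that cl by (auto simp: in_arcs_def G)
    moreover have "out_arcs G u = Pair u ` {k. (u, k) \<in> E}"
      using that cl by (auto simp: out_arcs_def G)
    ultimately show ?thesis
      unfolding in_degree_def out_degree_def using bal[of u]
      by (simp add: card_image inj_on_def)
  qed
  ultimately obtain u p where "euler_trail u p u" using closed_euler1 by blast
  then have up: "trail u p u" "set p = arcs G" "set (awalk_verts u p) = verts G"
    by (auto simp: euler_trail_def)
  obtain q where q: "trail d q d" "set q = arcs G" "set (awalk_verts d q) = verts G"
    using rotate_trailE'[OF up(1), of d] up(2,3) dR G by metis
  have cas: "cas d q d" and "distinct q" using q(1) by (auto simp: trail_def awalk_def)
  have "q \<noteq> []" using q(2) out cl dR by (auto simp: G)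
  then obtain q' a where q': "q = q' @ [a]" by (metis rev_exhaust)
  have "awlast d q = d" using q(1) by (auto simp: trail_def awalk_def)
  (* the trail ends at d, so dropping its last arc leaves exactly the intermediate vertices *)
  then have verts: "d # map snd q = d # map snd q' @ [d]"
    using cas_awalk_verts[OF cas] by (simp add: q' G)
  show ?thesis
  proof
    have "set (d # map snd q) = R" using q(3) cas_awalk_verts[OF cas] by (simp add: G)
    then show "set (d # map snd q') = R" using verts by auto
    fix T :: "'a \<Rightarrow> 'a \<Rightarrow> real"
    have "route_length T (d # map snd q' @ [d]) = (\<Sum>e\<leftarrow>q. T (fst e) (snd e))"
      using route_length_awalk_verts[OF cas, of T] verts by (simp add: G)
    also have "\<dots> = (\<Sum>(a, b)\<in>E \<inter> R \<times> R. T a b)"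
      using \<open>distinct q\<close> q(2) by (simp add: sum_list_distinct_conv_sum_set G case_prod_unfold)
    finally show "route_length T (d # map snd q' @ [d]) = (\<Sum>(a, b)\<in>E \<inter> R \<times> R. T a b)" .
  qed
qed

section \<open>The cyclic tour through a list of stops\<close>

text \<open>
  The \<open>r\<close>-th arc of the closed tour \<open>d, ps, d\<close> leads from entry \<open>r\<close> of \<open>d # ps\<close> to entry \<open>r\<close> of
  \<open>ps @ [d]\<close>, and \<open>g r\<close> is the value placed on it: \<open>1\<close> for the driving variables, the load of the
  vehicle for the flow variables. Being a sum over positions, it turns every sum over
  locations, after exchanging the summations, into the lookup of one position.
\<close>

definition tour_edges :: "'a \<Rightarrow> 'a list \<Rightarrow> (nat \<Rightarrow> real) \<Rightarrow> 'a \<Rightarrow> 'a \<Rightarrow> real" where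
  "tour_edges d ps g i k =
     (\<Sum>r\<le>length ps. of_bool (i = (d # ps) ! r \<and> k = (ps @ [d]) ! r) * g r)"

lemma sum_tour_edges_out:
  assumes "finite K"
  shows "(\<Sum>k\<in>K. tour_edges d ps g i k * c k) =
    (\<Sum>r\<le>length ps. of_bool (i = (d # ps) ! r \<and> (ps @ [d]) ! r \<in> K) * g r * c ((ps @ [d]) ! r))"
proof -
  have "(\<Sum>k\<in>K. of_bool (i = (d # ps) ! r \<and> k = (ps @ [d]) ! r) * g r * c k) =
    of_bool (i = (d # ps) ! r \<and> (ps @ [d]) ! r \<in> K) * g r * c ((ps @ [d]) ! r)" (is "?L = ?R") for r
  proof -
    have "?L = (\<Sum>k\<in>K. if k = (ps @ [d]) ! r then of_bool (i = (d # ps) ! r) * g r * c k else 0)"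
      by (intro sum.cong) auto
    then show ?thesis using assms by (simp add: sum.delta')
  qed
  then show ?thesis
    unfolding tour_edges_def sum_distrib_right
    by (subst sum.swap) simp
qed

lemma sum_tour_edges_in:
  assumes "finite K"
  shows "(\<Sum>i\<in>K. tour_edges d ps g i k) =
    (\<Sum>r\<le>length ps. of_bool ((d # ps) ! r \<in> K \<and> k = (ps @ [d]) ! r) * g r)"
proof -
  have "(\<Sum>i\<in>K. of_bool (i = (d # ps) ! r \<and> k = (ps @ [d]) ! r) * g r) =
    of_bool ((d # ps) ! r \<in> K \<and> k = (ps @ [d]) ! r) * g r" (is "?L = ?R") for r
  proof -
    have "?L = (\<Sum>i\<in>K. if i = (d # ps) ! r then of_bool (k = (ps @ [d]) ! r) * g r else 0)"
      by (intro sum.cong) auto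
    then show ?thesis using assms by (simp add: sum.delta')
  qed
  then show ?thesis
    unfolding tour_edges_def
    by (subst sum.swap) simp
qed

locale simple_tour =
  fixes d :: 'a and ps :: "'a list"
  assumes distinct_stops: "distinct (d # ps)"
begin

lemma succ_nth [simp]: "j < length ps \<Longrightarrow> (ps @ [d]) ! j = ps ! j"
  by (simp add: nth_append)

lemma start_eq_iff:
  "r \<le> length ps \<Longrightarrow> r' \<le> length ps \<Longrightarrow> (d # ps) ! r = (d # ps) ! r' \<longleftrightarrow> r = r'"
  using nth_eq_iff_index_eq[OF distinct_stops, of r r'] by simp

lemma end_eq_iff:
  "r \<le> length ps \<Longrightarrow> r' \<le> length ps \<Longrightarrow> (ps @ [d]) ! r = (ps @ [d]) ! r' \<longleftrightarrow> r = r'"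
  using nth_eq_iff_index_eq[of "ps @ [d]" r r'] distinct_stops by simp

lemma start_ne_end:
  assumes "ps \<noteq> []" "r \<le> length ps"
  shows "(d # ps) ! r \<noteq> (ps @ [d]) ! r"
proof (cases r)
  case 0
  then show ?thesis using assms distinct_stops by (auto simp: nth_append)
next
  case (Suc j)
  have "ps ! j \<noteq> (ps @ [d]) ! Suc j"
    using end_eq_iff[of j "Suc j"] Suc assms by simp
  then show ?thesis using Suc by simp
qed

lemma start_in: "r \<le> length ps \<Longrightarrow> (d # ps) ! r \<in> insert d (set ps)"
  using nth_mem[of r "d # ps"] by auto

lemma end_in: "r \<le> length ps \<Longrightarrow> (ps @ [d]) ! r \<in> insert d (set ps)"
  using nth_mem[of r "ps @ [d]"] by auto

lemma tour_edges_nonneg: "(\<And>r. r \<le> length ps \<Longrightarrow> g r \<ge> 0) \<Longrightarrow> tour_edges d ps g i k \<ge> 0"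
  unfolding tour_edges_def by (intro sum_nonneg) auto

text \<open>
  Distinct stops give distinct arcs, so at most one position contributes. The position does not
  depend on \<open>g\<close>, which makes it possible to compare the flow and the driving variable of the same arc.
\<close>

lemma tour_edges_cases:
  "tour_edges d ps g i k = 0 \<or>
   (\<exists>r\<le>length ps. i = (d # ps) ! r \<and> k = (ps @ [d]) ! r \<and> (\<forall>g. tour_edges d ps g i k = g r))"
proof (cases "\<exists>r\<le>length ps. i = (d # ps) ! r \<and> k = (ps @ [d]) ! r")
  case True
  then obtain r where r: "r \<le> length ps" "i = (d # ps) ! r" "k = (ps @ [d]) ! r" by auto
  have "tour_edges d ps g i k = g r" for g
  proof -
    have "tour_edges d ps g i k = (\<Sum>s\<le>length ps. if s = r then g s else 0)"
      unfolding tour_edges_def using r start_eq_iff by (intro sum.cong) (auto simp del: nth_Cons_Suc)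
    then show ?thesis using r by simp
  qed
  then show ?thesis using r by blast
next
  case False
  then have "tour_edges d ps g i k = 0"
    unfolding tour_edges_def by (intro sum.neutral) auto
  then show ?thesis by simp
qed

lemma sum_out_start:
  assumes "finite K" "j \<le> length ps"
  shows "(\<Sum>k\<in>K. tour_edges d ps g ((d # ps) ! j) k) = of_bool ((ps @ [d]) ! j \<in> K) * g j"
proof -
  have "(\<Sum>k\<in>K. tour_edges d ps g ((d # ps) ! j) k * 1) =
    (\<Sum>r\<le>length ps. if r = j then of_bool ((ps @ [d]) ! j \<in> K) * g j else 0)"
    unfolding sum_tour_edges_out[OF assms(1), where c = "\<lambda>_. 1"]
    using start_eq_iff assms(2) by (intro sum.cong) auto
  then show ?thesis using assms(2) by simp
qed

lemma sum_in_end: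
  assumes "finite K" "j \<le> length ps"
  shows "(\<Sum>i\<in>K. tour_edges d ps g i ((ps @ [d]) ! j)) = of_bool ((d # ps) ! j \<in> K) * g j"
proof -
  have "(\<Sum>i\<in>K. tour_edges d ps g i ((ps @ [d]) ! j)) =
    (\<Sum>r\<le>length ps. if r = j then of_bool ((d # ps) ! j \<in> K) * g j else 0)"
    unfolding sum_tour_edges_in[OF assms(1)]
    using end_eq_iff assms(2) by (intro sum.cong) auto
  then show ?thesis using assms(2) by simp
qed

lemma tour_edges_off_tour:
  assumes "i \<notin> insert d (set ps) \<or> k \<notin> insert d (set ps)"
  shows "tour_edges d ps g i k = 0"
  unfolding tour_edges_def
proof (intro sum.neutral ballI)
  fix r assume "r \<in> {..length ps}"
  then show "of_bool (i = (d # ps) ! r \<and> k = (ps @ [d]) ! r) * g r = 0"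
    using assms start_in[of r] end_in[of r] by auto
qed

lemma sum_tour_edges_cost:
  assumes "finite L" "insert d (set ps) \<subseteq> L" "ps \<noteq> []"
  shows "(\<Sum>i\<in>L. \<Sum>k\<in>L - {i}. tour_edges d ps (\<lambda>_. 1) i k * c i k) = route_length c (d # ps @ [d])"
proof -
  have "(\<Sum>i\<in>L. \<Sum>k\<in>L - {i}. tour_edges d ps (\<lambda>_. 1) i k * c i k) =
    (\<Sum>i\<in>L. \<Sum>r\<le>length ps. of_bool (i = (d # ps) ! r) * c i ((ps @ [d]) ! r))"
  proof (intro sum.cong refl)
    fix i assume "i \<in> L"
    have eq: "of_bool (i = (d # ps) ! r \<and> (ps @ [d]) ! r \<in> L - {i}) * 1 * c i ((ps @ [d]) ! r) =
      of_bool (i = (d # ps) ! r) * c i ((ps @ [d]) ! r)" if "r \<le> length ps" for r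
      using start_ne_end[OF assms(3) that] end_in[OF that] assms(2) by auto
    show "(\<Sum>k\<in>L - {i}. tour_edges d ps (\<lambda>_. 1) i k * c i k) =
      (\<Sum>r\<le>length ps. of_bool (i = (d # ps) ! r) * c i ((ps @ [d]) ! r))"
      unfolding sum_tour_edges_out[OF finite_Diff[OF assms(1)]]
      by (intro sum.cong refl eq) simp
  qed
  also have "\<dots> = (\<Sum>r\<le>length ps. \<Sum>i\<in>L. of_bool (i = (d # ps) ! r) * c i ((ps @ [d]) ! r))"
    by (rule sum.swap)
  also have "\<dots> = (\<Sum>r\<le>length ps. c ((d # ps) ! r) ((ps @ [d]) ! r))"
  proof (intro sum.cong refl)
    fix r assume "r \<in> {..length ps}"
    then have "(d # ps) ! r \<in> L" using start_in[of r] assms(2) by auto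
    moreover have "(\<Sum>i\<in>L. of_bool (i = (d # ps) ! r) * c i ((ps @ [d]) ! r)) =
      (\<Sum>i\<in>L. if i = (d # ps) ! r then c i ((ps @ [d]) ! r) else 0)"
      by (intro sum.cong) auto
    ultimately show "(\<Sum>i\<in>L. of_bool (i = (d # ps) ! r) * c i ((ps @ [d]) ! r)) =
      c ((d # ps) ! r) ((ps @ [d]) ! r)"
      using assms(1) by simp
  qed
  also have "\<dots> = route_length c (d # ps @ [d])"
    unfolding route_length_eq_sum_nth
    by (intro sum.cong) (auto simp: nth_Cons nth_append split: nat.splits)
  finally show ?thesis .
qed

end

section \<open>Delivery plans\<close>

lemma sum_Nats: "(\<And>x. x \<in> A \<Longrightarrow> f x \<in> \<nat>) \<Longrightarrow> sum f A \<in> \<nat>"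
  by (induction A rule: infinite_finite_induct) (auto intro: Nats_add)

definition demand :: "'a cdpp \<Rightarrow> ('a \<Rightarrow> 'a set \<Rightarrow> real) \<Rightarrow> 'a \<Rightarrow> real" where
  "demand I y k = (\<Sum>\<sigma>\<in>service_sets I. real (card \<sigma>) * y k \<sigma>)"

text \<open>
  The part of feasibility that concerns \<open>y\<close> alone. Values are only asked to be natural numbers,
  because the covering equations force them to be at most \<open>1\<close>.
\<close>

definition assignment :: "'a cdpp \<Rightarrow> ('a \<Rightarrow> 'a set \<Rightarrow> real) \<Rightarrow> bool" where
  "assignment I y \<longleftrightarrow>
     (\<forall>k\<in>parking I. \<forall>\<sigma>\<in>service_sets I. y k \<sigma> \<in> \<nat>) \<and>
     (\<forall>i\<in>customers I. (\<Sum>k\<in>parking I. \<Sum>\<sigma>\<in>service_sets_of I i. y k \<sigma>) = 1)"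

locale cdpp_setting =
  fixes I :: "'a cdpp"
  assumes inst: "cdpp_instance I"
begin

lemma finite_customers [simp]: "finite (customers I)"
  and finite_locs [simp]: "finite (locs I)"
  and finite_parking [simp]: "finite (parking I)"
  and depot_in_locs [simp]: "depot I \<in> locs I"
  and depot_not_customer: "depot I \<notin> customers I"
  using inst by (auto simp: cdpp_instance_def parking_def)

lemma finite_service_sets [simp]: "finite (service_sets I)"
  by (rule finite_subset[of _ "Pow (customers I)"]) (auto simp: service_sets_def)

lemma finite_service_sets_of [simp]: "finite (service_sets_of I i)"
  by (simp add: service_sets_of_def)

lemma finite_service_set: "\<sigma> \<in> service_sets I \<Longrightarrow> finite \<sigma>"
  by (auto simp: service_sets_def intro: finite_subset[of _ "customers I"])

lemma singleton_service_set: "i \<in> customers I \<Longrightarrow> {i} \<in> service_sets I"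
  using inst by (auto simp: service_sets_def cdpp_instance_def)

text \<open>
  Weights and volumes are nonnegative, so a smaller set of packages is no heavier and no bulkier.
\<close>

lemma service_set_subset:
  assumes "\<tau> \<in> service_sets I" "\<sigma> \<subseteq> \<tau>" "\<sigma> \<noteq> {}"
  shows "\<sigma> \<in> service_sets I"
proof -
  have fin: "finite \<tau>" using assms(1) by (rule finite_service_set)
  have nonneg: "weight I i \<ge> 0" "volume I i \<ge> 0" if "i \<in> \<tau>" for i
    using inst that assms(1) by (auto simp: cdpp_instance_def service_sets_def)
  have "card \<sigma> \<le> card \<tau>" "sum (weight I) \<sigma> \<le> sum (weight I) \<tau>" "sum (volume I) \<sigma> \<le> sum (volume I) \<tau>"
    using fin assms(2) nonneg by (auto intro!: card_mono sum_mono2)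
  then show ?thesis
    using assms by (fastforce simp: service_sets_def within_capacity_def)
qed

lemma assignment_nonneg:
  "assignment I y \<Longrightarrow> k \<in> parking I \<Longrightarrow> \<sigma> \<in> service_sets I \<Longrightarrow> y k \<sigma> \<ge> 0"
  unfolding assignment_def by (metis Nats_cases of_nat_0_le_iff)

text \<open>
  A service set contains some customer, and \<open>y k \<sigma>\<close> is one of the nonnegative summands of the
  covering equation of that customer.
\<close>

lemma assignment_le_1:
  assumes y: "assignment I y" and k: "k \<in> parking I" and \<sigma>: "\<sigma> \<in> service_sets I"
  shows "y k \<sigma> \<le> 1"
proof -
  obtain i where i: "i \<in> \<sigma>" "i \<in> customers I" using \<sigma> by (auto simp: service_sets_def)
  have nn: "y k' \<tau> \<ge> 0" if "k' \<in> parking I" "\<tau> \<in> service_sets_of I i" for k' \<tau>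
    using assignment_nonneg[OF y] that by (auto simp: service_sets_of_def)
  have "y k \<sigma> \<le> (\<Sum>\<tau>\<in>service_sets_of I i. y k \<tau>)"
    using i \<sigma> k nn by (intro member_le_sum) (auto simp: service_sets_of_def)
  also have "\<dots> \<le> (\<Sum>k\<in>parking I. \<Sum>\<tau>\<in>service_sets_of I i. y k \<tau>)"
    using k nn by (intro member_le_sum[where f = "\<lambda>k. \<Sum>\<tau>\<in>service_sets_of I i. y k \<tau>"] sum_nonneg) auto
  also have "\<dots> = 1" using y i by (auto simp: assignment_def)
  finally show ?thesis .
qed

lemma assignment_binary:
  assumes "assignment I y" "k \<in> parking I" "\<sigma> \<in> service_sets I"
  shows "y k \<sigma> \<in> {0, 1}"
proof -
  have "y k \<sigma> \<in> \<nat>" using assms by (auto simp: assignment_def)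
  then obtain m where "y k \<sigma> = real m" by (auto elim: Nats_cases)
  then show ?thesis using assignment_le_1[OF assms] by auto
qed

lemma demand_nonneg: "assignment I y \<Longrightarrow> k \<in> parking I \<Longrightarrow> demand I y k \<ge> 0"
  unfolding demand_def using assignment_nonneg by (intro sum_nonneg mult_nonneg_nonneg) auto

lemma demand_Nats: "assignment I y \<Longrightarrow> k \<in> parking I \<Longrightarrow> demand I y k \<in> \<nat>"
  unfolding demand_def assignment_def by (intro sum_Nats Nats_mult) auto

lemma demand_pos:
  assumes "assignment I y" "k \<in> parking I" "\<sigma> \<in> service_sets I" "y k \<sigma> \<noteq> 0"
  shows "demand I y k > 0"
proof -
  have "card \<sigma> > 0" using assms(3) finite_service_set by (auto simp: service_sets_def card_gt_0_iff)
  then have "0 < real (card \<sigma>) * y k \<sigma>"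
    using assignment_nonneg[OF assms(1-3)] assms(4) by simp
  also have "\<dots> \<le> demand I y k"
    unfolding demand_def using assms assignment_nonneg
    by (intro member_le_sum[where f = "\<lambda>\<sigma>. real (card \<sigma>) * y k \<sigma>"]) auto
  finally show ?thesis .
qed

text \<open>
  Double counting of the pairs of a customer and a service set containing that customer.
\<close>

lemma total_demand:
  assumes "assignment I y"
  shows "(\<Sum>k\<in>parking I. demand I y k) = real (card (customers I))"
proof -
  have "demand I y k = (\<Sum>i\<in>customers I. \<Sum>\<sigma>\<in>service_sets_of I i. y k \<sigma>)" for k
  proof -
    have "(\<Sum>i\<in>customers I. \<Sum>\<sigma>\<in>service_sets_of I i. y k \<sigma>) =
      (\<Sum>i\<in>customers I. \<Sum>\<sigma>\<in>service_sets I. if i \<in> \<sigma> then y k \<sigma> else 0)"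
      unfolding service_sets_of_def by (intro sum.cong refl sum.inter_filter) simp
    also have "\<dots> = (\<Sum>\<sigma>\<in>service_sets I. \<Sum>i\<in>customers I. if i \<in> \<sigma> then y k \<sigma> else 0)"
      by (rule sum.swap)
    also have "\<dots> = demand I y k"
      unfolding demand_def
    proof (intro sum.cong refl)
      fix \<sigma> assume "\<sigma> \<in> service_sets I"
      then have "customers I \<inter> \<sigma> = \<sigma>" by (auto simp: service_sets_def)
      then show "(\<Sum>i\<in>customers I. if i \<in> \<sigma> then y k \<sigma> else 0) = real (card \<sigma>) * y k \<sigma>"
        by (simp add: sum.inter_restrict[symmetric])
    qed
    finally show ?thesis by simp
  qed
  then have "(\<Sum>k\<in>parking I. demand I y k) =
    (\<Sum>i\<in>customers I. \<Sum>k\<in>parking I. \<Sum>\<sigma>\<in>service_sets_of I i. y k \<sigma>)"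
    by (simp add: sum.swap[of _ "customers I"])
  then show ?thesis using assms by (simp add: assignment_def)
qed

lemma feasible_imp_assignment:
  assumes "cdpp_feasible I x y v"
  shows "assignment I y"
proof -
  have "y k \<sigma> \<in> {0, 1}" if "k \<in> parking I" "\<sigma> \<in> service_sets I" for k \<sigma>
    using assms that unfolding cdpp_feasible_def by blast
  then have "y k \<sigma> \<in> \<nat>" if "k \<in> parking I" "\<sigma> \<in> service_sets I" for k \<sigma>
    using that by (metis Nats_0 Nats_1 empty_iff insert_iff)
  moreover have "\<forall>i\<in>customers I. (\<Sum>k\<in>parking I. \<Sum>\<sigma>\<in>service_sets_of I i. y k \<sigma>) = 1"
    using assms unfolding cdpp_feasible_def by blast
  ultimately show ?thesis by (simp add: assignment_def)
qed

text \<open>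
  The load of the vehicle on its way to stop \<open>r\<close>: what it still has to deliver there and later.
\<close>

definition remaining_demand :: "('a \<Rightarrow> 'a set \<Rightarrow> real) \<Rightarrow> 'a list \<Rightarrow> nat \<Rightarrow> real" where
  "remaining_demand y ps r = (\<Sum>s\<in>{r..<length ps}. demand I y (ps ! s))"

definition stops_cover :: "('a \<Rightarrow> 'a set \<Rightarrow> real) \<Rightarrow> 'a list \<Rightarrow> bool" where
  "stops_cover y ps \<longleftrightarrow> distinct ps \<and> set ps \<subseteq> parking I \<and>
     (\<forall>k\<in>parking I - set ps. \<forall>\<sigma>\<in>service_sets I. y k \<sigma> = 0)"

abbreviation tour_arcs :: "'a list \<Rightarrow> 'a \<Rightarrow> 'a \<Rightarrow> real" where
  "tour_arcs ps \<equiv> tour_edges (depot I) ps (\<lambda>_. 1)"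

abbreviation tour_flow :: "('a \<Rightarrow> 'a set \<Rightarrow> real) \<Rightarrow> 'a list \<Rightarrow> 'a \<Rightarrow> 'a \<Rightarrow> real" where
  "tour_flow y ps \<equiv> tour_edges (depot I) ps (remaining_demand y ps)"

context
  fixes y ps
  assumes y: "assignment I y" and ps: "stops_cover y ps"
begin

interpretation simple_tour "depot I" ps
  using ps by unfold_locales (auto simp: stops_cover_def parking_def)

text \<open>
  There is at least one customer, and a tour without stops could not serve that customer. This
  excludes the degenerate tour consisting of the loop from the depot to itself, which is not an
  arc of the program.
\<close>

lemma stops_nonempty: "ps \<noteq> []"
proof
  assume "ps = []"
  then have "demand I y k = 0" if "k \<in> parking I" for k
    using ps that by (auto simp: stops_cover_def demand_def)
  then have "real (card (customers I)) = 0" using total_demand[OF y] by simp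
  then show False using inst by (auto simp: cdpp_instance_def)
qed

lemma stop_in_locs: "insert (depot I) (set ps) \<subseteq> locs I"
  using ps by (auto simp: stops_cover_def parking_def)

lemma tour_in_degree:
  assumes "j < length ps"
  shows "(\<Sum>k\<in>locs I - {ps ! j}. tour_edges (depot I) ps g k (ps ! j)) = g j"
proof -
  have "(depot I # ps) ! j \<in> locs I - {ps ! j}"
    using start_ne_end[OF stops_nonempty, of j] start_in[of j] stop_in_locs assms by auto
  then show ?thesis
    using sum_in_end[of "locs I - {ps ! j}" j g] assms by simp
qed

lemma tour_out_degree:
  assumes "j < length ps"
  shows "(\<Sum>k\<in>locs I - {ps ! j}. tour_edges (depot I) ps g (ps ! j) k) = g (Suc j)"
proof -
  have "(ps @ [depot I]) ! Suc j \<in> locs I - {ps ! j}"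
    using start_ne_end[OF stops_nonempty, of "Suc j"] end_in[of "Suc j"] stop_in_locs assms by auto
  then show ?thesis
    using sum_out_start[of "locs I - {ps ! j}" "Suc j" g] assms by simp
qed

lemma tour_degrees_unvisited:
  assumes "i \<in> parking I" "i \<notin> set ps"
  shows "(\<Sum>k\<in>K. tour_edges (depot I) ps g k i) = 0" "(\<Sum>k\<in>K. tour_edges (depot I) ps g i k) = 0"
  using assms tour_edges_off_tour by (auto simp: parking_def intro!: sum.neutral)

lemma remaining_demand_Nats: "remaining_demand y ps r \<in> \<nat>"
  unfolding remaining_demand_def using ps
  by (intro sum_Nats demand_Nats[OF y]) (auto simp: stops_cover_def)

lemma remaining_demand_0: "remaining_demand y ps 0 = real (card (customers I))"
proof -
  have "remaining_demand y ps 0 = (\<Sum>k\<in>set ps. demand I y k)"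
    unfolding remaining_demand_def using ps
    by (intro sum.reindex_bij_betw bij_betw_nth) (auto simp: stops_cover_def lessThan_atLeast0)
  also have "\<dots> = (\<Sum>k\<in>parking I. demand I y k)"
    using ps by (intro sum.mono_neutral_left) (auto simp: stops_cover_def demand_def)
  finally show ?thesis using total_demand[OF y] by simp
qed

lemma remaining_demand_le: "remaining_demand y ps r \<le> real (card (customers I))"
  unfolding remaining_demand_0[symmetric] unfolding remaining_demand_def using ps
  by (intro sum_mono2 demand_nonneg[OF y]) (auto simp: stops_cover_def)

lemma remaining_demand_Suc:
  "j < length ps \<Longrightarrow> remaining_demand y ps j = demand I y (ps ! j) + remaining_demand y ps (Suc j)"
  unfolding remaining_demand_def by (simp add: sum.atLeast_Suc_lessThan)

text \<open>
  Driving to stop \<open>j\<close> and driving away from it, the vehicle carries the demand of the stops from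
  \<open>j\<close> on and from \<open>Suc j\<close> on. At the last stop the flow back to the depot is left out of the balance
  equation, which is harmless because the remaining demand is then zero.
\<close>

lemma tour_flow_balance:
  assumes "i \<in> parking I"
  shows "(\<Sum>k\<in>locs I - {i}. tour_flow y ps k i) - (\<Sum>k\<in>locs I - {depot I, i}. tour_flow y ps i k) =
    demand I y i"
proof (cases "i \<in> set ps")
  case True
  then obtain j where j: "j < length ps" "i = ps ! j" by (auto simp: in_set_conv_nth)
  have "(\<Sum>k\<in>locs I - {depot I, i}. tour_flow y ps i k) = remaining_demand y ps (Suc j)"
  proof (cases "Suc j < length ps")
    case True
    then have "ps ! Suc j \<in> parking I" using ps by (auto simp: stops_cover_def)
    moreover have "ps ! Suc j \<noteq> ps ! j" using start_ne_end[OF stops_nonempty, of "Suc j"] True by simp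
    ultimately show ?thesis
      using sum_out_start[of "locs I - {depot I, i}" "Suc j" "remaining_demand y ps"] j True
      by (auto simp: parking_def)
  next
    case False
    then have "remaining_demand y ps (Suc j) = 0" by (simp add: remaining_demand_def)
    then show ?thesis
      using sum_out_start[of "locs I - {depot I, i}" "Suc j" "remaining_demand y ps"] j by simp
  qed
  then show ?thesis using tour_in_degree[OF j(1)] remaining_demand_Suc[OF j(1)] j by simp
next
  case False
  then have "demand I y i = 0" using ps assms by (auto simp: stops_cover_def demand_def)
  then show ?thesis using tour_degrees_unvisited[OF assms False] by simp
qed

text \<open>
  An assignment together with a simple tour through all parking locations that it uses extends to a
  feasible solution: the route determines the driving variables, and the remaining demand determines
  the flow.
\<close>

lemma tour_feasible: "cdpp_feasible I (tour_arcs ps) y (tour_flow y ps)"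
proof -
  have first: "ps ! 0 \<in> parking I" and last: "(depot I # ps) ! length ps \<in> parking I"
    using stops_nonempty ps by (auto simp: stops_cover_def nth_Cons split: nat.splits)
  have start: "(\<Sum>i\<in>parking I. tour_edges (depot I) ps g (depot I) i) = g 0" for g
    using sum_out_start[of "parking I" 0 g] first stops_nonempty by simp
  have finish: "(\<Sum>i\<in>parking I. tour_arcs ps i (depot I)) = 1"
    using sum_in_end[of "parking I" "length ps" "\<lambda>_. 1"] last by simp
  have balanced: "(\<Sum>k\<in>locs I - {i}. tour_arcs ps k i) = (\<Sum>k\<in>locs I - {i}. tour_arcs ps i k)"
    and served: "\<sigma> \<in> service_sets I \<Longrightarrow> y i \<sigma> \<le> (\<Sum>k\<in>locs I - {i}. tour_arcs ps k i)"
    if i: "i \<in> parking I" for i \<sigma>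
  proof -
    have "(\<Sum>k\<in>locs I - {i}. tour_arcs ps k i) = (\<Sum>k\<in>locs I - {i}. tour_arcs ps i k) \<and>
      (\<sigma> \<in> service_sets I \<longrightarrow> y i \<sigma> \<le> (\<Sum>k\<in>locs I - {i}. tour_arcs ps k i))"
    proof (cases "i \<in> set ps")
      case True
      then obtain j where "j < length ps" "i = ps ! j" by (auto simp: in_set_conv_nth)
      then show ?thesis
        using tour_in_degree tour_out_degree assignment_le_1[OF y i] by simp
    next
      case False
      then show ?thesis using tour_degrees_unvisited[OF i False] ps i by (auto simp: stops_cover_def)
    qed
    then show "(\<Sum>k\<in>locs I - {i}. tour_arcs ps k i) = (\<Sum>k\<in>locs I - {i}. tour_arcs ps i k)"
      and "\<sigma> \<in> service_sets I \<Longrightarrow> y i \<sigma> \<le> (\<Sum>k\<in>locs I - {i}. tour_arcs ps k i)" by auto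
  qed
  have bound: "tour_flow y ps i k \<le> real (card (customers I)) * tour_arcs ps i k" for i k
    using tour_edges_cases[of "remaining_demand y ps" i k] remaining_demand_le
      tour_edges_nonneg[of "\<lambda>_. 1" i k] by auto
  have binary: "tour_arcs ps i k \<in> {0, 1}" for i k
    using tour_edges_cases[of "\<lambda>_. 1" i k] by auto
  have integral: "tour_flow y ps i k \<in> \<nat>" for i k
    using tour_edges_cases[of "remaining_demand y ps" i k] remaining_demand_Nats by auto
  have cover: "(\<Sum>k\<in>parking I. \<Sum>\<sigma>\<in>service_sets_of I i. y k \<sigma>) = 1" if "i \<in> customers I" for i
    using y that by (auto simp: assignment_def)
  show ?thesis
    unfolding cdpp_feasible_def
    by (intro conjI ballI impI)
      (rule start finish start[of "remaining_demand y ps", unfolded remaining_demand_0] cover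
          balanced served bound tour_flow_balance[unfolded demand_def] binary assignment_binary[OF y] integral; assumption)+
qed

lemma tour_cost:
  "cdpp_cost I (tour_arcs ps) y = route_length (drive_cost I) (depot I # ps @ [depot I]) +
     (\<Sum>i\<in>parking I. \<Sum>\<sigma>\<in>service_sets I. y i \<sigma> * (walk_cost I i \<sigma> + load_time I \<sigma>))"
  unfolding cdpp_cost_def
  by (simp add: sum_tour_edges_cost[OF finite_locs stop_in_locs stops_nonempty])

end

end

section \<open>From a feasible solution to a simple tour\<close>

lemma sum_off_diagonal_swap:
  assumes "finite U"
  shows "(\<Sum>i\<in>U. \<Sum>k\<in>U - {i}. g i k) = (\<Sum>i\<in>U. \<Sum>k\<in>U - {i}. g k i :: real)"
proof -
  have off: "(\<Sum>k\<in>U - {i}. h k) = (\<Sum>k\<in>U. if i = k then 0 else h k)" for i and h :: "'a \<Rightarrow> real"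
    using assms by (intro sum.mono_neutral_cong_left) auto
  show ?thesis
    unfolding off by (subst sum.swap) (simp add: eq_commute)
qed

context cdpp_setting
begin

lemma drive_cost_nonneg: "i \<in> locs I \<Longrightarrow> k \<in> locs I \<Longrightarrow> drive_cost I i k \<ge> 0"
  using inst by (auto simp: cdpp_instance_def travel_time_on_def drive_cost_def parking_def)

text \<open>
  The time to park is charged on arrival, so a detour through \<open>b\<close> costs the search time at \<open>b\<close>
  in addition to the extra driving time.
\<close>

lemma drive_cost_triangle:
  assumes "a \<in> locs I" "b \<in> locs I" "c \<in> locs I"
  shows "drive_cost I a c \<le> drive_cost I a b + drive_cost I b c"
proof -
  have "drive I a c \<le> drive I a b + drive I b c"
    using inst assms unfolding cdpp_instance_def travel_time_on_def by blast
  moreover have "search_time I b \<ge> 0" if "b \<noteq> depot I"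
    using inst that assms by (auto simp: cdpp_instance_def parking_def)
  ultimately show ?thesis by (auto simp: drive_cost_def)
qed

context
  fixes x y v
  assumes feas: "cdpp_feasible I x y v"
begin

definition used_arcs :: "('a \<times> 'a) set" where
  "used_arcs = {(i, k). i \<in> locs I \<and> k \<in> locs I \<and> i \<noteq> k \<and> x i k = 1}"

text \<open>
  Feasible driving variables may contain closed tours that miss the depot; this is the part of the
  route that the vehicle can really drive.
\<close>

definition depot_component :: "'a set" where
  "depot_component = (used_arcs \<union> used_arcs\<inverse>)\<^sup>* `` {depot I}"

lemma x_binary: "i \<in> locs I \<Longrightarrow> k \<in> locs I \<Longrightarrow> i \<noteq> k \<Longrightarrow> x i k = 0 \<or> x i k = 1"
  using feas unfolding cdpp_feasible_def by blast

lemma x_eq_of_bool: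
  "i \<in> locs I \<Longrightarrow> k \<in> locs I \<Longrightarrow> i \<noteq> k \<Longrightarrow> x i k = of_bool ((i, k) \<in> used_arcs)"
  using x_binary[of i k] by (auto simp: used_arcs_def)

lemma finite_used_arcs: "finite used_arcs"
  by (rule finite_subset[of _ "locs I \<times> locs I"]) (auto simp: used_arcs_def)

lemma out_degree_eq:
  assumes "i \<in> locs I"
  shows "(\<Sum>k\<in>locs I - {i}. x i k) = real (card {k. (i, k) \<in> used_arcs})"
proof -
  have "(\<Sum>k\<in>locs I - {i}. x i k) = (\<Sum>k\<in>locs I - {i}. of_bool ((i, k) \<in> used_arcs))"
    using assms x_eq_of_bool by (intro sum.cong) auto
  also have "\<dots> = real (card ((locs I - {i}) \<inter> {k. (i, k) \<in> used_arcs}))"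
    by simp
  also have "(locs I - {i}) \<inter> {k. (i, k) \<in> used_arcs} = {k. (i, k) \<in> used_arcs}"
    by (auto simp: used_arcs_def)
  finally show ?thesis .
qed

lemma in_degree_eq:
  assumes "i \<in> locs I"
  shows "(\<Sum>k\<in>locs I - {i}. x k i) = real (card {k. (k, i) \<in> used_arcs})"
proof -
  have "(\<Sum>k\<in>locs I - {i}. x k i) = (\<Sum>k\<in>locs I - {i}. of_bool ((k, i) \<in> used_arcs))"
    using assms x_eq_of_bool by (intro sum.cong) auto
  also have "\<dots> = real (card ((locs I - {i}) \<inter> {k. (k, i) \<in> used_arcs}))"
    by simp
  also have "(locs I - {i}) \<inter> {k. (k, i) \<in> used_arcs} = {k. (k, i) \<in> used_arcs}"
    by (auto simp: used_arcs_def)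
  finally show ?thesis .
qed

lemma depot_degrees:
  "card {k. (depot I, k) \<in> used_arcs} = 1" "card {k. (k, depot I) \<in> used_arcs} = 1"
  using feas in_degree_eq[of "depot I"] out_degree_eq[of "depot I"]
  by (simp_all add: cdpp_feasible_def parking_def)

lemma used_arcs_balanced: "card {k. (u, k) \<in> used_arcs} = card {k. (k, u) \<in> used_arcs}"
proof (cases "u \<in> locs I")
  case True
  show ?thesis
  proof (cases "u = depot I")
    case False
    then have "u \<in> parking I" using True by (simp add: parking_def)
    then have "(\<Sum>k\<in>locs I - {u}. x k u) = (\<Sum>k\<in>locs I - {u}. x u k)"
      using feas unfolding cdpp_feasible_def by blast
    then show ?thesis using in_degree_eq[OF True] out_degree_eq[OF True] by simp
  qed (simp add: depot_degrees)
next
  case False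
  then have "{k. (u, k) \<in> used_arcs} = {}" "{k. (k, u) \<in> used_arcs} = {}"
    by (auto simp: used_arcs_def)
  then show ?thesis by simp
qed

lemma sum_used_arcs:
  "(\<Sum>(i, k)\<in>used_arcs. c i k) = (\<Sum>i\<in>locs I. \<Sum>k\<in>locs I - {i}. x i k * c i k)"
proof -
  have "(\<Sum>i\<in>locs I. \<Sum>k\<in>locs I - {i}. x i k * c i k) =
    (\<Sum>(i, k)\<in>Sigma (locs I) (\<lambda>i. locs I - {i}). x i k * c i k)"
    by (simp add: sum.Sigma)
  also have "\<dots> = (\<Sum>(i, k)\<in>used_arcs. c i k)"
    using x_binary by (intro sum.mono_neutral_cong_right) (auto simp: used_arcs_def dest: x_binary)
  finally show ?thesis by simp
qed

lemma depot_component_subset: "depot_component \<subseteq> locs I"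
proof
  fix z assume "z \<in> depot_component"
  then have "(depot I, z) \<in> (used_arcs \<union> used_arcs\<inverse>)\<^sup>*" by (simp add: depot_component_def)
  then show "z \<in> locs I" by induction (auto simp: used_arcs_def)
qed

lemma flow_facts:
  assumes "i \<in> locs I" "k \<in> parking I" "i \<noteq> k"
  shows "v i k \<ge> 0" "v i k \<le> real (card (customers I)) * x i k"
proof -
  have "v i k \<in> \<nat>" using feas assms unfolding cdpp_feasible_def by blast
  then show "v i k \<ge> 0" by (auto elim: Nats_cases)
  show "v i k \<le> real (card (customers I)) * x i k"
    using feas assms unfolding cdpp_feasible_def by blast
qed

text \<open>
  No used arc enters the complement of the component, hence no flow does. Adding up the flow balances
  over the complement, the flow inside it cancels, and the total demand there is at most zero.
\<close>

lemma no_demand_outside_depot_component: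
  assumes "k \<in> parking I" "k \<notin> depot_component" "\<sigma> \<in> service_sets I"
  shows "y k \<sigma> = 0"
proof (rule ccontr)
  assume "y k \<sigma> \<noteq> 0"
  have y: "assignment I y" using feas by (rule feasible_imp_assignment)
  define U where "U = parking I - depot_component"
  have U: "finite U" "U \<subseteq> parking I" "U \<subseteq> locs I" "depot I \<notin> U"
    by (auto simp: U_def parking_def)
  have net: "demand I y i \<le> (\<Sum>k\<in>U - {i}. v k i) - (\<Sum>k\<in>U - {i}. v i k)" if i: "i \<in> U" for i
  proof -
    have iP: "i \<in> parking I" using i U by auto
    have "v k i = 0" if "k \<in> locs I - {i} - (U - {i})" for k
    proof -
      have k: "k \<in> locs I" "k \<noteq> i" "k \<in> depot_component"
        using that by (auto simp: U_def parking_def depot_component_def)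
      have "(k, i) \<notin> used_arcs"
      proof
        assume "(k, i) \<in> used_arcs"
        then have "i \<in> depot_component"
          using k(3) unfolding depot_component_def by (auto intro: rtrancl_into_rtrancl)
        then show False using i by (simp add: U_def)
      qed
      then have "x k i = 0" using x_eq_of_bool[of k i] k i U by auto
      then show ?thesis using flow_facts[of k i] k iP by auto
    qed
    then have "(\<Sum>k\<in>locs I - {i}. v k i) = (\<Sum>k\<in>U - {i}. v k i)"
      using U by (intro sum.mono_neutral_right) auto
    moreover have "(\<Sum>k\<in>U - {i}. v i k) \<le> (\<Sum>k\<in>locs I - {depot I, i}. v i k)"
      using U i flow_facts(1)[of i] by (intro sum_mono2) (auto simp: parking_def)
    moreover have "(\<Sum>k\<in>locs I - {i}. v k i) - (\<Sum>k\<in>locs I - {depot I, i}. v i k) = demand I y i"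
      using feas iP unfolding cdpp_feasible_def demand_def by blast
    ultimately show ?thesis by simp
  qed
  have "(\<Sum>i\<in>U. demand I y i) \<le> (\<Sum>i\<in>U. (\<Sum>k\<in>U - {i}. v k i) - (\<Sum>k\<in>U - {i}. v i k))"
    by (intro sum_mono net)
  also have "\<dots> = 0"
    using sum_off_diagonal_swap[OF U(1), of v] by (simp add: sum_subtractf)
  finally have "(\<Sum>i\<in>U. demand I y i) \<le> 0" .
  moreover have "demand I y k \<le> (\<Sum>i\<in>U. demand I y i)"
    using U assms demand_nonneg[OF y] by (intro member_le_sum) (auto simp: U_def)
  moreover have "demand I y k > 0"
    using demand_pos[OF y assms(1,3) \<open>y k \<sigma> \<noteq> 0\<close>] .
  ultimately show False by simp
qed

text \<open>
  The closed Euler trail through the depot component visits all parking locations with demand, and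
  shortcutting repeated visits makes it a simple tour. Shortcutting one repeated visit within the
  program would not do, as the direct arc may be in use already; passing to the whole trail first
  avoids this.
\<close>

lemma shortcut_tour:
  obtains ps where "stops_cover y ps"
    and "route_length (drive_cost I) (depot I # ps @ [depot I]) \<le>
      (\<Sum>i\<in>locs I. \<Sum>k\<in>locs I - {i}. x i k * drive_cost I i k)"
proof -
  let ?c = "drive_cost I" and ?R = depot_component
  have "{k. (depot I, k) \<in> used_arcs} \<noteq> {}" using depot_degrees(1) by force
  then obtain e where e: "(depot I, e) \<in> used_arcs" by auto
  obtain ws where ws: "set (depot I # ws) = ?R"
    "\<And>T. route_length T (depot I # ws @ [depot I]) = (\<Sum>(a, b)\<in>used_arcs \<inter> ?R \<times> ?R. T a b)"
    using closed_route_through_component[OF finite_used_arcs used_arcs_balanced e depot_component_def]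
    by blast
  define ps where "ps = remdups (removeAll (depot I) ws)"
  have sub: "subseq ps ws"
    unfolding ps_def removeAll_filter_not_eq
    by (rule subseq_order.trans[OF subseq_remdups subseq_filter_left])
  have setps: "set ps = ?R - {depot I}"
    using ws(1) by (auto simp: ps_def)
  show ?thesis
  proof
    show "stops_cover y ps"
      using setps depot_component_subset no_demand_outside_depot_component
      by (auto simp: stops_cover_def ps_def parking_def)
    have "route_length ?c (depot I # ps @ [depot I]) \<le> route_length ?c (depot I # ws @ [depot I])"
      using ws(1) depot_component_subset
      by (intro route_length_subseq_le[OF sub, where A = "locs I"] drive_cost_triangle) auto
    also have "\<dots> = (\<Sum>(a, b)\<in>used_arcs \<inter> ?R \<times> ?R. ?c a b)" by (rule ws(2))
    also have "\<dots> \<le> (\<Sum>(a, b)\<in>used_arcs. ?c a b)"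
      using finite_used_arcs drive_cost_nonneg by (intro sum_mono2) (auto simp: used_arcs_def)
    also have "\<dots> = (\<Sum>i\<in>locs I. \<Sum>k\<in>locs I - {i}. x i k * ?c i k)" by (rule sum_used_arcs)
    finally show "route_length ?c (depot I # ps @ [depot I]) \<le> \<dots>" .
  qed
qed

end

section \<open>Serving a customer from the vehicle parked at that customer\<close>

text \<open>
  All customers of \<open>A\<close> are taken out of their service sets at once, and each is served alone from the
  vehicle parked at that customer. The sum collects the service sets that become \<open>\<tau>\<close>; sets that
  become empty disappear because \<open>\<tau>\<close> only ranges over service sets.
\<close>

definition serve_in_place :: "'a set \<Rightarrow> ('a \<Rightarrow> 'a set \<Rightarrow> real) \<Rightarrow> 'a \<Rightarrow> 'a set \<Rightarrow> real" where
  "serve_in_place A y k \<tau> =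
     (\<Sum>\<sigma>\<in>service_sets I. of_bool (\<sigma> - A = \<tau>) * y k \<sigma>) + of_bool (k \<in> A \<and> \<tau> = {k})"

text \<open>
  Change of variables \<open>\<tau> = \<sigma> - A\<close>. With \<open>h\<close> indicating whether a fixed customer belongs to a set, it yields the covering
  equations, and with \<open>h\<close> the walking time it yields the cost comparison.
\<close>

lemma sum_serve_in_place:
  assumes "A \<subseteq> customers I"
  shows "(\<Sum>\<tau>\<in>service_sets I. serve_in_place A y k \<tau> * h \<tau>) =
    (\<Sum>\<sigma>\<in>service_sets I. of_bool (\<sigma> - A \<noteq> {}) * y k \<sigma> * h (\<sigma> - A)) + of_bool (k \<in> A) * h {k}"
proof -
  have "(\<Sum>\<tau>\<in>service_sets I. serve_in_place A y k \<tau> * h \<tau>) =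
    (\<Sum>\<tau>\<in>service_sets I. \<Sum>\<sigma>\<in>service_sets I. of_bool (\<sigma> - A = \<tau>) * y k \<sigma> * h \<tau>) +
    (\<Sum>\<tau>\<in>service_sets I. of_bool (k \<in> A \<and> \<tau> = {k}) * h \<tau>)"
    by (simp only: serve_in_place_def distrib_right sum.distrib sum_distrib_right)
  also have "(\<Sum>\<tau>\<in>service_sets I. of_bool (k \<in> A \<and> \<tau> = {k}) * h \<tau>) =
    (\<Sum>\<tau>\<in>service_sets I. if \<tau> = {k} then of_bool (k \<in> A) * h {k} else 0)"
    by (intro sum.cong) auto
  also have "\<dots> = of_bool (k \<in> A) * h {k}"
    using singleton_service_set[of k] assms by auto
  also have "(\<Sum>\<tau>\<in>service_sets I. \<Sum>\<sigma>\<in>service_sets I. of_bool (\<sigma> - A = \<tau>) * y k \<sigma> * h \<tau>) =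
    (\<Sum>\<sigma>\<in>service_sets I. \<Sum>\<tau>\<in>service_sets I. of_bool (\<sigma> - A = \<tau>) * y k \<sigma> * h \<tau>)"
    by (rule sum.swap)
  also have "\<dots> = (\<Sum>\<sigma>\<in>service_sets I. of_bool (\<sigma> - A \<noteq> {}) * y k \<sigma> * h (\<sigma> - A))"
  proof (intro sum.cong refl)
    fix \<sigma> assume "\<sigma> \<in> service_sets I"
    then have iff: "\<sigma> - A \<in> service_sets I \<longleftrightarrow> \<sigma> - A \<noteq> {}"
      using service_set_subset[of \<sigma> "\<sigma> - A"] by (auto simp: service_sets_def)
    have "(\<Sum>\<tau>\<in>service_sets I. of_bool (\<sigma> - A = \<tau>) * y k \<sigma> * h \<tau>) =
      (\<Sum>\<tau>\<in>service_sets I. if \<tau> = \<sigma> - A then y k \<sigma> * h (\<sigma> - A) else 0)"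
      by (intro sum.cong) auto
    also have "\<dots> = of_bool (\<sigma> - A \<noteq> {}) * y k \<sigma> * h (\<sigma> - A)"
      using iff by simp
    finally show "(\<Sum>\<tau>\<in>service_sets I. of_bool (\<sigma> - A = \<tau>) * y k \<sigma> * h \<tau>) =
      of_bool (\<sigma> - A \<noteq> {}) * y k \<sigma> * h (\<sigma> - A)" .
  qed
  finally show ?thesis .
qed

lemma sum_service_sets_of:
  "(\<Sum>\<sigma>\<in>service_sets_of I i. g \<sigma>) = (\<Sum>\<sigma>\<in>service_sets I. g \<sigma> * of_bool (i \<in> \<sigma>) :: real)"
proof -
  have "(\<Sum>\<sigma>\<in>service_sets_of I i. g \<sigma>) = (\<Sum>\<sigma>\<in>service_sets I. if i \<in> \<sigma> then g \<sigma> else 0)"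
    unfolding service_sets_of_def by (intro sum.inter_filter) simp
  also have "\<dots> = (\<Sum>\<sigma>\<in>service_sets I. g \<sigma> * of_bool (i \<in> \<sigma>))"
    by (intro sum.cong) auto
  finally show ?thesis .
qed

text \<open>
  A customer outside \<open>A\<close> stays in the reduced service sets and keeps the old covering equation; a
  customer in \<open>A\<close> is in none of the reduced sets and is covered by its new singleton only.
\<close>

lemma serve_in_place_assignment:
  assumes y: "assignment I y" and A: "A \<subseteq> customers I" "A \<subseteq> parking I"
  shows "assignment I (serve_in_place A y)"
  unfolding assignment_def
proof (intro conjI ballI)
  fix k \<tau> assume "k \<in> parking I" "\<tau> \<in> service_sets I"
  then show "serve_in_place A y k \<tau> \<in> \<nat>"
    unfolding serve_in_place_def using y
    by (intro Nats_add sum_Nats Nats_mult) (auto simp: assignment_def)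
next
  fix i assume i: "i \<in> customers I"
  have "(\<Sum>k\<in>parking I. \<Sum>\<tau>\<in>service_sets_of I i. serve_in_place A y k \<tau>) =
    (\<Sum>k\<in>parking I. (\<Sum>\<sigma>\<in>service_sets I. of_bool (\<sigma> - A \<noteq> {}) * y k \<sigma> * of_bool (i \<in> \<sigma> - A)) +
      of_bool (k \<in> A) * of_bool (i \<in> {k}))"
    by (simp only: sum_service_sets_of sum_serve_in_place[OF A(1)])
  also have "\<dots> = (\<Sum>k\<in>parking I. of_bool (i \<notin> A) * (\<Sum>\<sigma>\<in>service_sets_of I i. y k \<sigma>) +
      (if k = i then of_bool (i \<in> A) else 0))"
    unfolding sum_service_sets_of sum_distrib_left
    by (intro sum.cong arg_cong2[where f = "(+)"]) auto
  also have "\<dots> = of_bool (i \<notin> A) * (\<Sum>k\<in>parking I. \<Sum>\<sigma>\<in>service_sets_of I i. y k \<sigma>) +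
      of_bool (i \<in> A \<and> i \<in> parking I)"
    by (simp add: sum.distrib sum_distrib_left)
  also have "\<dots> = 1" using y i A by (auto simp: assignment_def)
  finally show "(\<Sum>k\<in>parking I. \<Sum>\<tau>\<in>service_sets_of I i. serve_in_place A y k \<tau>) = 1" .
qed

lemma serve_in_place_singleton:
  assumes y: "assignment I y" and A: "A \<subseteq> customers I" "A \<subseteq> parking I" and k: "k \<in> A"
  shows "serve_in_place A y k {k} = 1"
proof -
  have kP: "k \<in> parking I" "{k} \<in> service_sets I" using k A singleton_service_set by auto
  have "(\<Sum>\<sigma>\<in>service_sets I. of_bool (\<sigma> - A = {k}) * y k \<sigma>) \<ge> 0"
    using assignment_nonneg[OF y kP(1)] by (intro sum_nonneg) auto
  then have "serve_in_place A y k {k} \<ge> 1" using k by (simp add: serve_in_place_def)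
  then show ?thesis using assignment_le_1[OF serve_in_place_assignment[OF y A] kP] by simp
qed

lemma serve_in_place_stops_cover:
  "stops_cover y ps \<Longrightarrow> A \<subseteq> set ps \<Longrightarrow> stops_cover (serve_in_place A y) ps"
  by (auto simp: stops_cover_def serve_in_place_def)

text \<open>
  Reduced service sets are no longer to walk, and a customer at the parked vehicle needs no walk.
\<close>

lemma serve_in_place_walk_le:
  assumes y: "assignment I y" and A: "A \<subseteq> customers I" and k: "k \<in> parking I"
  shows "(\<Sum>\<tau>\<in>service_sets I. serve_in_place A y k \<tau> * walk_cost I k \<tau>) \<le>
    (\<Sum>\<sigma>\<in>service_sets I. y k \<sigma> * walk_cost I k \<sigma>)"
proof -
  have W: "travel_time_on (customers I \<union> parking I) (walk I)"
    using inst by (simp add: cdpp_instance_def)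
  then have self: "walk I k k = 0" using k by (auto simp: travel_time_on_def)
  have mono: "walk_cost I k \<tau> \<le> walk_cost I k \<sigma>" if "\<tau> \<subseteq> \<sigma>" "\<sigma> \<in> service_sets I" for \<tau> \<sigma>
    using that k finite_service_set by (intro walk_cost_mono[OF W]) (auto simp: service_sets_def)
  have empty: "walk_cost I k {} = 0"
    using self by (simp add: walk_cost_def tour_time_def)
  have "of_bool (\<sigma> - A \<noteq> {}) * y k \<sigma> * walk_cost I k (\<sigma> - A) \<le> y k \<sigma> * walk_cost I k \<sigma>"
    if \<sigma>: "\<sigma> \<in> service_sets I" for \<sigma>
  proof -
    have "y k \<sigma> * walk_cost I k (\<sigma> - A) \<le> y k \<sigma> * walk_cost I k \<sigma>"
      using mono[of "\<sigma> - A" \<sigma>] \<sigma> assignment_nonneg[OF y k \<sigma>] by (intro mult_left_mono) auto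
    then show ?thesis using empty by (cases "\<sigma> - A = {}") (simp_all del: Diff_eq_empty_iff)
  qed
  then show ?thesis
    unfolding sum_serve_in_place[OF A] walk_cost_at_customer[of I k, OF self]
    by (simp add: sum_mono)
qed

text \<open>
  With loading times proportional to the number of packages, every assignment has the same total
  loading time, so only the walking times matter.
\<close>

lemma service_cost_split:
  assumes y: "assignment I y"
    and load: "\<And>\<sigma>. \<sigma> \<in> service_sets I \<Longrightarrow> load_time I \<sigma> = f * real (card \<sigma>)"
  shows "(\<Sum>k\<in>parking I. \<Sum>\<sigma>\<in>service_sets I. y k \<sigma> * (walk_cost I k \<sigma> + load_time I \<sigma>)) =
    (\<Sum>k\<in>parking I. \<Sum>\<sigma>\<in>service_sets I. y k \<sigma> * walk_cost I k \<sigma>) + f * real (card (customers I))"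
proof -
  have "(\<Sum>\<sigma>\<in>service_sets I. y k \<sigma> * (walk_cost I k \<sigma> + load_time I \<sigma>)) =
    (\<Sum>\<sigma>\<in>service_sets I. y k \<sigma> * walk_cost I k \<sigma>) + f * demand I y k" for k
    using load by (simp add: demand_def distrib_left sum.distrib sum_distrib_left mult_ac)
  then show ?thesis
    by (simp add: sum.distrib sum_distrib_left[symmetric] total_demand[OF y])
qed

section \<open>Optimal solutions\<close>

text \<open>
  Park once, anywhere, and serve every customer separately from there.
\<close>

lemma feasible_exists: "\<exists>x y v. cdpp_feasible I x y v"
proof -
  obtain p where p: "p \<in> parking I" using inst by (auto simp: cdpp_instance_def)
  define y :: "'a \<Rightarrow> 'a set \<Rightarrow> real" where "y k \<sigma> = of_bool (k = p \<and> (\<exists>i. \<sigma> = {i}))" for k \<sigma>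
  have "assignment I y"
    unfolding assignment_def
  proof (intro conjI ballI)
    fix i assume i: "i \<in> customers I"
    have "(\<Sum>k\<in>parking I. \<Sum>\<sigma>\<in>service_sets_of I i. y k \<sigma>) =
      (\<Sum>k\<in>parking I. \<Sum>\<sigma>\<in>service_sets_of I i. if \<sigma> = {i} then if k = p then 1 else 0 else 0)"
      by (intro sum.cong refl) (auto simp: y_def service_sets_of_def)
    also have "\<dots> = 1"
      using p singleton_service_set[OF i] by (simp add: service_sets_of_def)
    finally show "(\<Sum>k\<in>parking I. \<Sum>\<sigma>\<in>service_sets_of I i. y k \<sigma>) = 1" .
  qed (simp add: y_def)
  moreover have "stops_cover y [p]" using p by (auto simp: stops_cover_def y_def)
  ultimately show ?thesis using tour_feasible by blast
qed

text \<open>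
  The cost depends on finitely many binary values only, so feasible solutions have finitely many costs.
\<close>

lemma optimal_exists: "\<exists>x y v. cdpp_optimal I x y v"
proof -
  define F where "F = {cdpp_cost I x y | x y v. cdpp_feasible I x y v}"
  let ?cost = "\<lambda>(X, Y). cdpp_cost I (\<lambda>i k. of_bool ((i, k) \<in> X)) (\<lambda>k \<sigma>. of_bool ((k, \<sigma>) \<in> Y))"
  have "F \<subseteq> ?cost ` (Pow (locs I \<times> locs I) \<times> Pow (parking I \<times> service_sets I))"
  proof
    fix c assume "c \<in> F"
    then obtain x y v where c: "c = cdpp_cost I x y" and feas: "cdpp_feasible I x y v"
      by (auto simp: F_def)
    let ?X = "{(i, k) \<in> locs I \<times> locs I. x i k = 1}"
    let ?Y = "{(k, \<sigma>) \<in> parking I \<times> service_sets I. y k \<sigma> = 1}"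
    have X: "x i k = of_bool ((i, k) \<in> ?X)" if "i \<in> locs I" "k \<in> locs I - {i}" for i k
    proof -
      have "x i k = 0 \<or> x i k = 1" using x_binary[OF feas, of i k] that by auto
      then show ?thesis using that by auto
    qed
    have Y: "y k \<sigma> = of_bool ((k, \<sigma>) \<in> ?Y)" if "k \<in> parking I" "\<sigma> \<in> service_sets I" for k \<sigma>
      using assignment_binary[OF feasible_imp_assignment[OF feas] that] that by auto
    have "c = ?cost (?X, ?Y)"
      unfolding c cdpp_cost_def prod.case using X Y
      by (intro arg_cong2[where f = "(+)"] sum.cong refl arg_cong2[where f = "(*)"]) simp_all
    then show "c \<in> ?cost ` (Pow (locs I \<times> locs I) \<times> Pow (parking I \<times> service_sets I))"
      by (rule image_eqI) auto
  qed
  then have "finite F" by (rule finite_subset) simp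
  moreover have "F \<noteq> {}" using feasible_exists by (auto simp: F_def)
  ultimately have "Min F \<in> F" "\<forall>c\<in>F. Min F \<le> c" by auto
  then show ?thesis unfolding cdpp_optimal_def F_def by auto metis
qed

end

section \<open>Arrivals at parking customers\<close>

theorem corollary4p1:
  fixes I :: "'a cdpp" and f :: real
  assumes "cdpp_instance I"
    and "f \<ge> 0"
    and "\<And>\<sigma>. \<sigma> \<in> service_sets I \<Longrightarrow> load_time I \<sigma> = f * real (card \<sigma>)"
  shows "\<exists>x y v. cdpp_optimal I x y v \<and>
    (\<Sum>i\<in>locs I \<inter> customers I. \<Sum>k\<in>locs I - {i}. x k i) = (\<Sum>i\<in>locs I \<inter> customers I. y i {i})"
proof -
  interpret cdpp_setting I using assms(1) by unfold_locales
  obtain x y v where opt: "cdpp_optimal I x y v" using optimal_exists by blast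
  then have feas: "cdpp_feasible I x y v" by (simp add: cdpp_optimal_def)
  then have y: "assignment I y" by (rule feasible_imp_assignment)
  obtain ps where ps: "stops_cover y ps"
    and drive: "route_length (drive_cost I) (depot I # ps @ [depot I]) \<le>
      (\<Sum>i\<in>locs I. \<Sum>k\<in>locs I - {i}. x i k * drive_cost I i k)"
    using shortcut_tour[OF feas] by blast
  define A where "A = set ps \<inter> customers I"
  have A: "A \<subseteq> customers I" "A \<subseteq> parking I" "A \<subseteq> set ps"
    using ps by (auto simp: A_def stops_cover_def)
  define y' where "y' = serve_in_place A y"
  have y': "assignment I y'" and ps': "stops_cover y' ps"
    unfolding y'_def using serve_in_place_assignment[OF y A(1,2)] serve_in_place_stops_cover[OF ps A(3)]
    by auto
  have "cdpp_cost I (tour_arcs ps) y' =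
    route_length (drive_cost I) (depot I # ps @ [depot I]) +
    (\<Sum>k\<in>parking I. \<Sum>\<sigma>\<in>service_sets I. y' k \<sigma> * walk_cost I k \<sigma>) + f * real (card (customers I))"
    using tour_cost[OF y' ps'] service_cost_split[OF y' assms(3)] by simp
  also have "\<dots> \<le> (\<Sum>i\<in>locs I. \<Sum>k\<in>locs I - {i}. x i k * drive_cost I i k) +
    (\<Sum>k\<in>parking I. \<Sum>\<sigma>\<in>service_sets I. y k \<sigma> * walk_cost I k \<sigma>) + f * real (card (customers I))"
    unfolding y'_def by (intro add_mono drive sum_mono serve_in_place_walk_le[OF y A(1)]) auto
  also have "\<dots> = cdpp_cost I x y"
    using service_cost_split[OF y assms(3)] by (simp add: cdpp_cost_def)
  finally have "cdpp_optimal I (tour_arcs ps) y' (tour_flow y' ps)"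
    using opt tour_feasible[OF y' ps'] unfolding cdpp_optimal_def by (meson order_trans)
  moreover have "(\<Sum>k\<in>locs I - {i}. tour_arcs ps k i) = y' i {i}" if "i \<in> locs I \<inter> customers I" for i
  proof (cases "i \<in> set ps")
    case True
    then obtain j where "j < length ps" "i = ps ! j" by (auto simp: in_set_conv_nth)
    then have "(\<Sum>k\<in>locs I - {i}. tour_arcs ps k i) = 1"
      using tour_in_degree[OF y' ps', of j] by simp
    moreover have "y' i {i} = 1"
      unfolding y'_def using serve_in_place_singleton[OF y A(1,2)] True that by (simp add: A_def)
    ultimately show ?thesis by simp
  next
    case False
    have i: "i \<in> parking I" using that depot_not_customer by (auto simp: parking_def)
    then have "y' i {i} = 0"
      using ps' False that singleton_service_set[of i] by (auto simp: stops_cover_def)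
    then show ?thesis using tour_degrees_unvisited(1)[OF y' ps' i False] by simp
  qed
  ultimately show ?thesis
    by (intro exI[of _ "tour_arcs ps"] exI[of _ y'] exI[of _ "tour_flow y' ps"] conjI sum.cong) auto
qed

end
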